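(* Let $n$ be a positive integer and let $\mathbf H=(H_1,\dots,H_{2n+1})$ be a $(2n+1)$-tuple of non-empty subsets of $\{+,-\}$. Then $$\sum_{\pi\in\mathcal B_{2n+1}(\mathbf H)}(-1)^{\mathrm{inv}(|\pi|)}t^{\mathrm{fdes}(\pi)} = (1-t^2)^n \sum_{\mathbf S_k\in\mathbb F(\mathbf H)}\ \sum_{\pi\in\mathcal B_{n+1}(\mathbf S_k)}t^{\mathrm{fdes}(\pi)}.$$ In particular, $$\sum_{\pi\in\mathcal B_{2n+1}}(-1)^{\mathrm{inv}(|\pi|)}t^{\mathrm{fdes}(\pi)} = (1-t^2)^n \sum_{\pi\in\mathcal B_{n+1}}t^{\mathrm{fdes}(\pi)}.$$
   Context: For $N\ge1$, $\mathcal B_N$ is the group of signed permutations: words $\pi=\pi_1\pi_2\cdots\pi_N$ with $\pi_i\in\{\pm1,\dots,\pm N\}$ such that $|\pi|:=|\pi_1||\pi_2|\cdots|\pi_N|$ is a permutation of $\{1,\dots,N\}$. Write $\bar i=-i$. $\mathrm{inv}(|\pi|)=|\{(i,j):i<j,\ |\pi_i|>|\pi_j|\}|$. Flag descent number: $\mathrm{fdes}(\pi)=2\,\mathrm{des}_F(\pi)+\delta(\pi_1<0)$, where $\mathrm{des}_F(\pi)=|\{i\in\{1,\dots,N-1\}:\pi_i>\pi_{i+1}\}|$ with respect to the linear order $\bar1<\bar2<\cdots<\bar N<1<2<\cdots<N$, and $\delta(\mathsf A)=1$ if $\mathsf A$ is true and $0$ otherwise. Restricted signed permutations: for an $N$-tuple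 $\mathbf S=(S_1,\dots,S_N)$ of subsets of $\{+,-\}$, $\mathcal B_N(\mathbf S)$ is the set of $\pi\in\mathcal B_N$ such that the sign of $\pi_i$ belongs to $S_i$ for every $i$ (empty if some $S_i=\emptyset$). A marked tuple $\mathbf S_k$ ($1\le k\le N$) is such a tuple $\mathbf S$ together with a distinguished position $k$; $\mathcal B_N(\mathbf S_k)$ is the set of $\pi\in\mathcal B_N(\mathbf S)$ with $|\pi_k|=N$. For $\mathbf H=(H_1,\dots,H_{2n+1})$, $\mathbb F(\mathbf H)$ is the collection of the $n+1$ marked $(n+1)$-tuples $\mathbf S_k=(S_1,\dots,S_{n+1})$ with mark at $k$, one for each $k\in\{1,\dots,n+1\}$, given by $$S_i=\begin{cases}H_{2i-1}\cap H_{2i},& i<k,\\ H_{2i-1},& i=k,\\ H_{2i-2}\cap H_{2i-1},& i>k.\end{cases}$$ $t$ is an indeterminate. *)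

theory Defs
  imports
    "HOL-Combinatorics.Multiset_Permutations"
    "HOL-Computational_Algebra.Polynomial"
begin

text \<open>Words and tuples are lists. Positions are counted from 1 throughout.\<close>

abbreviation nth1 :: "'a list \<Rightarrow> nat \<Rightarrow> 'a"  (infixl "!\<^sub>1" 100)
  where "xs !\<^sub>1 i \<equiv> xs ! (i - 1)"

text \<open>The entries lie in \<open>{\<plusminus>1, \<dots>, \<plusminus>N}\<close> and the word has length \<open>N\<close>,
  because the word of absolute values is a permutation of \<open>{1, \<dots>, N}\<close>.\<close>

definition signed_perms :: "nat \<Rightarrow> int list set" where
  "signed_perms N = {\<pi>. map abs \<pi> \<in> permutations_of_set {1..int N}}"

definition inv_num :: "int list \<Rightarrow> nat" where
  "inv_num w = card {(i, j). 1 \<le> i \<and> i < j \<and> j \<le> length w \<and> w !\<^sub>1 i > w !\<^sub>1 j}"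

text \<open>The linear order \<open>-1 < -2 < \<dots> < -N < 1 < 2 < \<dots> < N\<close> (on nonzero integers).\<close>

definition less_F :: "int \<Rightarrow> int \<Rightarrow> bool" where
  "less_F a b \<longleftrightarrow> (a < 0 \<and> b > 0) \<or> (sgn a = sgn b \<and> \<bar>a\<bar> < \<bar>b\<bar>)"

definition des_F :: "int list \<Rightarrow> nat" where
  "des_F \<pi> = card {i \<in> {1..length \<pi> - 1}. less_F (\<pi> !\<^sub>1 (i + 1)) (\<pi> !\<^sub>1 i)}"

definition fdes :: "int list \<Rightarrow> nat" where
  "fdes \<pi> = 2 * des_F \<pi> + of_bool (\<pi> !\<^sub>1 1 < 0)"

datatype psign = Plus | Minus

definition sign_of :: "int \<Rightarrow> psign" where
  "sign_of a = (if a < 0 then Minus else Plus)"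

definition restricted_perms :: "psign set list \<Rightarrow> int list set" where
  "restricted_perms S =
     {\<pi> \<in> signed_perms (length S). \<forall>i \<in> {1..length S}. sign_of (\<pi> !\<^sub>1 i) \<in> S !\<^sub>1 i}"

text \<open>A marked tuple is a pair of a tuple and its distinguished position.\<close>

fun marked_perms :: "psign set list \<times> nat \<Rightarrow> int list set" where
  "marked_perms (S, k) = {\<pi> \<in> restricted_perms S. \<bar>\<pi> !\<^sub>1 k\<bar> = int (length S)}"

definition marked_tuple :: "nat \<Rightarrow> psign set list \<Rightarrow> nat \<Rightarrow> psign set list \<times> nat" where
  "marked_tuple n H k =
     (map (\<lambda>i. if i < k then H !\<^sub>1 (2*i - 1) \<inter> H !\<^sub>1 (2*i)
               else if i = k then H !\<^sub>1 (2*i - 1)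
               else H !\<^sub>1 (2*i - 2) \<inter> H !\<^sub>1 (2*i - 1)) [1..<n+2], k)"

definition marked_tuples :: "nat \<Rightarrow> psign set list \<Rightarrow> (psign set list \<times> nat) set" where
  "marked_tuples n H = marked_tuple n H ` {1..n+1}"

text \<open>Sums over \<open>signed_perms N\<close> and its subsets are sums over finite sets.\<close>

lemma finite_signed_perms: "finite (signed_perms N)"
proof (rule finite_subset)
  show "signed_perms N \<subseteq> {xs. set xs \<subseteq> {- int N..int N} \<and> length xs = N}"
  proof
    fix \<pi> assume "\<pi> \<in> signed_perms N"
    then have *: "map abs \<pi> \<in> permutations_of_set {1..int N}"
      by (simp add: signed_perms_def)
    have "length \<pi> = N"
      using length_finite_permutations_of_set[OF *] by simp
    moreover have "abs ` set \<pi> = {1..int N}"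
      using permutations_of_setD(1)[OF *] by simp
    then have "\<bar>x\<bar> \<le> int N" if "x \<in> set \<pi>" for x
      using that by (metis atLeastAtMost_iff imageI)
    then have "set \<pi> \<subseteq> {- int N..int N}"
      by (force simp: abs_le_iff)
    ultimately show "\<pi> \<in> {xs. set xs \<subseteq> {- int N..int N} \<and> length xs = N}" by simp
  qed
qed (intro finite_lists_length_eq finite_atLeastAtMost_int)

end

theory Submission
  imports Defs
begin

text \<open>The idea is to pair the values: $1$ with $2$, $3$ with $4$, and so on up to $2n-1$ with $2n$, which
leaves the value $2n+1$ alone. For each $i \le n$, exchanging the absolute values $2i-1$ and $2i$
in a word, with the sign at each position kept, is an involution of the restricted signed
permutations, because the restriction concerns signs at positions only. These $n$ involutions commute.
Starting from a word in which $2i-1$ stands to the left of $2i$, the exchange adds one inversion.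
It leaves every comparison of neighbouring letters unchanged, except when the two letters of the pair
are themselves adjacent with the same sign; then it turns an ascent into a descent. So the weight
$(-1)^{\mathrm{inv}} t^{\mathrm{fdes}}$ is multiplied by $-t^2$ in the exceptional case, and by $-1$
otherwise (\<open>inv_num_swap\<close>, \<open>fdes_swap\<close>). Summing over an orbit of all the involutions gives the weight of
its member with every pair in increasing order, times one factor $1-t^2$ or $1-1=0$ per pair
(\<open>sum_involutions_product\<close>). Only words in which every pair occupies adjacent positions with equal signs
and in increasing order survive, each with the factor $(1-t^2)^n$.

Without sign restrictions, merging each such pair into a single letter of absolute value $i$, and replacing the
absolute value $2n+1$ by $n+1$, gives a bijection from the surviving words to the signed permutations of
size $n+1$; its inverse is \<open>double_word\<close>. Doubling preserves the flag descent
number, and the doubled word has an even number of inversions. If $n+1$ is at position $k$ of the short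
word, then $2n+1$ is at position $2k-1$ of the doubled word; a letter at position $i < k$
supplies the signs at positions $2i-1$ and $2i$, one at $i > k$ those at $2i-2$ and $2i-1$.
The sign restriction on the doubled word is therefore exactly the one which the tuple marked at $k$
puts on the short word (\<open>double_word_restricted_iff_marked\<close>). The unrestricted identity is the case in which every
sign is allowed everywhere, so that every doubled word qualifies.\<close>

section \<open>Summation over commuting involutions\<close>

text \<open>When the involutions commute, each orbit contains exactly one element satisfying every \<open>P i\<close>, and the
other elements arise from it by applying the involutions with index in some subset \<open>J\<close> of \<open>I\<close>, which multiplies the weight by the
product of the \<open>c i\<close> over \<open>J\<close>. Summing over all \<open>J\<close> gives the product of the factors \<open>1 + c i\<close>.
The induction on \<open>I\<close> folds the sum along one involution at a time; the independence of different
involutions enters as the invariance of \<open>P j\<close> and \<open>c j\<close> under \<open>\<sigma> i\<close>.\<close>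

lemma sum_involutions_product:
  fixes f :: "'a \<Rightarrow> 'r::comm_ring_1" and c :: "'i \<Rightarrow> 'a \<Rightarrow> 'r"
  assumes "finite X" and "finite I"
    and closed: "\<And>i w. i \<in> I \<Longrightarrow> w \<in> X \<Longrightarrow> \<sigma> i w \<in> X"
    and invol: "\<And>i w. i \<in> I \<Longrightarrow> w \<in> X \<Longrightarrow> \<sigma> i (\<sigma> i w) = w"
    and flip: "\<And>i w. i \<in> I \<Longrightarrow> w \<in> X \<Longrightarrow> P i (\<sigma> i w) \<longleftrightarrow> \<not> P i w"
    and P_inv: "\<And>i j w. i \<in> I \<Longrightarrow> j \<in> I \<Longrightarrow> i \<noteq> j \<Longrightarrow> w \<in> X \<Longrightarrow> P j (\<sigma> i w) \<longleftrightarrow> P j w"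
    and c_inv: "\<And>i j w. i \<in> I \<Longrightarrow> j \<in> I \<Longrightarrow> i \<noteq> j \<Longrightarrow> w \<in> X \<Longrightarrow> c j (\<sigma> i w) = c j w"
    and weight: "\<And>i w. i \<in> I \<Longrightarrow> w \<in> X \<Longrightarrow> P i w \<Longrightarrow> f (\<sigma> i w) = c i w * f w"
  shows "(\<Sum>w\<in>X. f w) = (\<Sum>w | w \<in> X \<and> (\<forall>i\<in>I. P i w). f w * (\<Prod>i\<in>I. 1 + c i w))"
  using \<open>finite I\<close> closed invol flip P_inv c_inv weight
proof (induction I rule: finite_induct)
  case empty
  then show ?case by simp
next
  case (insert i J)
  define g where "g w = f w * (\<Prod>j\<in>J. 1 + c j w)" for w
  define A where "A = {w \<in> X. \<forall>j\<in>J. P j w}"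
  define A1 where "A1 = {w \<in> A. P i w}"
  define A0 where "A0 = {w \<in> A. \<not> P i w}"
  have ij: "j \<in> J \<Longrightarrow> i \<noteq> j" for j using insert.hyps by auto
  have "(\<Sum>w\<in>X. f w) = (\<Sum>w\<in>A. g w)"
    unfolding A_def g_def using insert.prems by (intro insert.IH) (rule insert.prems; simp)+
  also have "\<dots> = (\<Sum>w\<in>A1. g w) + (\<Sum>w\<in>A0. g w)"
  proof -
    have "A = A1 \<union> A0" "A1 \<inter> A0 = {}" "finite A1" "finite A0"
      using \<open>finite X\<close> by (auto simp: A_def A1_def A0_def)
    then show ?thesis by (simp add: sum.union_disjoint)
  qed
  also have "(\<Sum>w\<in>A0. g w) = (\<Sum>w\<in>A1. g (\<sigma> i w))"
  proof (rule sum.reindex_bij_witness[of _ "\<sigma> i" "\<sigma> i"])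
    fix w assume w: "w \<in> A0"
    then have "w \<in> X" by (simp add: A0_def A_def)
    then show "\<sigma> i (\<sigma> i w) = w" "\<sigma> i w \<in> A1" "g (\<sigma> i (\<sigma> i w)) = g w"
      using w insert.prems ij by (auto simp: A0_def A1_def A_def)
  next
    fix w assume w: "w \<in> A1"
    then have "w \<in> X" by (simp add: A1_def A_def)
    then show "\<sigma> i (\<sigma> i w) = w" "\<sigma> i w \<in> A0"
      using w insert.prems ij by (auto simp: A0_def A1_def A_def)
  qed
  also have "\<dots> = (\<Sum>w\<in>A1. c i w * g w)"
  proof (rule sum.cong[OF refl])
    fix w assume w: "w \<in> A1"
    then have "w \<in> X" "P i w" by (simp_all add: A1_def A_def)
    then have "f (\<sigma> i w) = c i w * f w" using insert.prems by simp
    moreover have "(\<Prod>j\<in>J. 1 + c j (\<sigma> i w)) = (\<Prod>j\<in>J. 1 + c j w)"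
      using insert.prems(5) ij \<open>w \<in> X\<close> by (intro prod.cong) auto
    ultimately show "g (\<sigma> i w) = c i w * g w" by (simp add: g_def mult.assoc)
  qed
  also have "(\<Sum>w\<in>A1. g w) + (\<Sum>w\<in>A1. c i w * g w)
      = (\<Sum>w\<in>A1. f w * (\<Prod>j\<in>insert i J. 1 + c j w))"
    using insert.hyps by (simp add: g_def sum.distrib[symmetric] algebra_simps)
  also have "A1 = {w \<in> X. \<forall>j\<in>insert i J. P j w}"
    by (auto simp: A1_def A_def)
  finally show ?case .
qed

section \<open>Signed permutations, inversions and descents\<close>

lemma signed_perms_iff:
  "w \<in> signed_perms N \<longleftrightarrow> distinct (map abs w) \<and> abs ` set w = {1..int N}"
  by (auto simp: signed_perms_def permutations_of_set_def)

lemma signed_perms_length: "w \<in> signed_perms N \<Longrightarrow> length w = N"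
  using distinct_card[of "map abs w"] by (simp add: signed_perms_iff)

lemma signed_perms_abs_eq:
  assumes "w \<in> signed_perms N" "p < length w" "q < length w" "\<bar>w ! p\<bar> = \<bar>w ! q\<bar>"
  shows "p = q"
  using assms nth_eq_iff_index_eq[of "map abs w" p q] by (simp add: signed_perms_iff)

lemma signed_perms_abs_occurs:
  assumes "w \<in> signed_perms N" "1 \<le> v" "v \<le> int N"
  obtains p where "p < length w" "\<bar>w ! p\<bar> = v"
proof -
  have "v \<in> abs ` set w" using assms by (simp add: signed_perms_iff)
  then show ?thesis using that by (auto simp: in_set_conv_nth)
qed

lemma inv_num_index:
  "inv_num w = card {(i, j). i < j \<and> j < length w \<and> w ! j < w ! i}"
  unfolding inv_num_def
  by (rule bij_betw_same_card[of "\<lambda>(i, j). (i - 1, j - 1)"],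
      rule bij_betwI[where g = "\<lambda>(i, j). (Suc i, Suc j)"]) auto

lemma des_F_index:
  "des_F w = card {i. Suc i < length w \<and> less_F (w ! Suc i) (w ! i)}" (is "_ = card ?B")
proof -
  have "{i \<in> {1..length w - 1}. less_F (w !\<^sub>1 (i + 1)) (w !\<^sub>1 i)} = Suc ` ?B" (is "?A = _")
  proof (intro equalityI subsetI)
    fix i assume "i \<in> ?A"
    then have "i - 1 \<in> ?B" "i = Suc (i - 1)" by auto
    then show "i \<in> Suc ` ?B" by blast
  qed auto
  then show ?thesis
    unfolding des_F_def by (simp add: card_image)
qed

lemma inv_num_Nil [simp]: "inv_num [] = 0"
  by (simp add: inv_num_index)

lemma inv_num_Cons:
  "inv_num (x # w) = length (filter (\<lambda>y. y < x) w) + inv_num w"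
proof -
  let ?I = "\<lambda>w::int list. {(i, j). i < j \<and> j < length w \<and> w ! j < w ! i}"
  let ?F = "{j. j < length w \<and> w ! j < x}"
  have fin: "finite (?I w)"
    by (rule finite_subset[of _ "{..<length w} \<times> {..<length w}"]) auto
  have "?I (x # w) = (\<lambda>j. (0, Suc j)) ` ?F \<union> map_prod Suc Suc ` ?I w"
  proof (intro equalityI subsetI)
    fix z assume z: "z \<in> ?I (x # w)"
    obtain i j where [simp]: "z = (i, j)" by (cases z)
    from z obtain j' where [simp]: "j = Suc j'" by (cases j) auto
    show "z \<in> (\<lambda>j. (0, Suc j)) ` ?F \<union> map_prod Suc Suc ` ?I w"
    proof (cases i)
      case 0
      with z show ?thesis by auto
    next
      case (Suc i')
      with z have "(i', j') \<in> ?I w" by auto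
      then have "map_prod Suc Suc (i', j') \<in> map_prod Suc Suc ` ?I w" by (rule imageI)
      then show ?thesis by (simp add: Suc)
    qed
  qed auto
  moreover have "card ((\<lambda>j. (0, Suc j)) ` ?F \<union> map_prod Suc Suc ` ?I w)
      = card ((\<lambda>j. (0::nat, Suc j)) ` ?F) + card (map_prod Suc Suc ` ?I w)"
    using fin by (intro card_Un_disjoint) auto
  moreover have "card ((\<lambda>j. (0::nat, Suc j)) ` ?F) = card ?F"
    by (intro card_image) (auto simp: inj_on_def)
  moreover have "card (map_prod Suc Suc ` ?I w) = card (?I w)"
    by (intro card_image) (auto simp: inj_on_def)
  ultimately show ?thesis
    by (simp add: inv_num_index length_filter_conv_card)
qed

lemma des_F_Nil [simp]: "des_F [] = 0"
  and des_F_single [simp]: "des_F [x] = 0"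
  by (simp_all add: des_F_index)

lemma des_F_Cons2:
  "des_F (x # y # w) = of_bool (less_F y x) + des_F (y # w)"
proof -
  let ?D = "\<lambda>w. {i. Suc i < length w \<and> less_F (w ! Suc i) (w ! i)}"
  have "?D (x # y # w) = (if less_F y x then {0} else {}) \<union> Suc ` ?D (y # w)"
  proof (intro equalityI subsetI)
    fix i assume "i \<in> ?D (x # y # w)"
    then show "i \<in> (if less_F y x then {0} else {}) \<union> Suc ` ?D (y # w)"
      by (cases i) auto
  qed (auto split: if_splits)
  moreover have "card ((if less_F y x then {0} else {}) \<union> Suc ` ?D (y # w))
      = card (if less_F y x then {0::nat} else {}) + card (Suc ` ?D (y # w))"
    by (intro card_Un_disjoint) auto
  ultimately show ?thesis
    by (simp add: des_F_index card_image)
qed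

section \<open>Exchanging two letters of consecutive absolute values\<close>

text \<open>A signed version of the transposition of $2i-1$ and $2i$: adding or subtracting the sign moves the
absolute value by one and keeps the sign.\<close>

definition swap_pair :: "int \<Rightarrow> int \<Rightarrow> int" where
  "swap_pair i x =
     (if \<bar>x\<bar> = 2 * i - 1 then x + sgn x else if \<bar>x\<bar> = 2 * i then x - sgn x else x)"

definition ordered_pair :: "int \<Rightarrow> int list \<Rightarrow> bool" where
  "ordered_pair i w \<longleftrightarrow>
     (\<exists>p q. p < q \<and> q < length w \<and> \<bar>w ! p\<bar> = 2 * i - 1 \<and> \<bar>w ! q\<bar> = 2 * i)"

text \<open>The last equation encodes both that the next letter has absolute value $2i$ and that it has the same sign.\<close>

definition joined_pair :: "int \<Rightarrow> int list \<Rightarrow> bool" where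
  "joined_pair i w \<longleftrightarrow>
     (\<exists>p. Suc p < length w \<and> \<bar>w ! p\<bar> = 2 * i - 1 \<and> w ! Suc p = w ! p + sgn (w ! p))"

lemma abs_swap_pair:
  "1 \<le> i \<Longrightarrow> \<bar>swap_pair i x\<bar> = (if \<bar>x\<bar> = 2*i-1 then 2*i else if \<bar>x\<bar> = 2*i then 2*i-1 else \<bar>x\<bar>)"
  by (auto simp: swap_pair_def sgn_if)

lemma sgn_swap_pair: "1 \<le> i \<Longrightarrow> sgn (swap_pair i x) = sgn x"
  by (auto simp: swap_pair_def sgn_if)

lemma swap_pair_neg_iff: "1 \<le> i \<Longrightarrow> swap_pair i x < 0 \<longleftrightarrow> x < 0"
  by (auto simp: swap_pair_def sgn_if)

lemma swap_pair_swap_pair: "1 \<le> i \<Longrightarrow> swap_pair i (swap_pair i x) = x"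
  by (auto simp: swap_pair_def sgn_if)

lemma swap_pair_signed_perms:
  assumes "1 \<le> i" "2 * i \<le> int N" "w \<in> signed_perms N"
  shows "map (swap_pair i) w \<in> signed_perms N"
proof -
  let ?tr = "Transposition.transpose (2 * i - 1) (2 * i)"
  have eq: "map abs (map (swap_pair i) w) = map ?tr (map abs w)"
    using assms(1) by (auto simp: abs_swap_pair Transposition.transpose_def)
  have perm: "?tr permutes {1..int N}"
    using assms by (intro permutes_swap_id) auto
  have "?tr ` {1..int N} = {1..int N}" by (rule permutes_image[OF perm])
  then have "set (map ?tr (map abs w)) = {1..int N}"
    using assms(3) by (metis list.set_map signed_perms_iff)
  moreover have "distinct (map ?tr (map abs w))"
    using assms(3) permutes_inj_on[OF perm] by (subst distinct_map) (simp add: signed_perms_iff)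
  ultimately show ?thesis
    unfolding signed_perms_def permutations_of_set_def eq[symmetric] by blast
qed

lemma ordered_pair_swap_same:
  assumes "1 \<le> i" "2 * i \<le> int N" "w \<in> signed_perms N"
  shows "ordered_pair i (map (swap_pair i) w) \<longleftrightarrow> \<not> ordered_pair i w"
proof -
  obtain p where p: "p < length w" "\<bar>w ! p\<bar> = 2 * i - 1"
    by (rule signed_perms_abs_occurs[of w N "2 * i - 1"]) (use assms in auto)
  obtain q where q: "q < length w" "\<bar>w ! q\<bar> = 2 * i"
    by (rule signed_perms_abs_occurs[of w N "2 * i"]) (use assms in auto)
  have pu: "p' = p" if "p' < length w" "\<bar>w ! p'\<bar> = 2 * i - 1" for p'
    using signed_perms_abs_eq[OF assms(3) that(1) p(1)] that p by simp
  have qu: "q' = q" if "q' < length w" "\<bar>w ! q'\<bar> = 2 * i" for q'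
    using signed_perms_abs_eq[OF assms(3) that(1) q(1)] that q by simp
  have "ordered_pair i w \<longleftrightarrow> p < q"
    unfolding ordered_pair_def using p q pu qu by (metis order.strict_trans)
  moreover have "ordered_pair i (map (swap_pair i) w) \<longleftrightarrow> q < p"
  proof
    assume "ordered_pair i (map (swap_pair i) w)"
    then obtain a b where ab: "a < b" "b < length w" "\<bar>swap_pair i (w ! a)\<bar> = 2 * i - 1"
        "\<bar>swap_pair i (w ! b)\<bar> = 2 * i"
      by (auto simp: ordered_pair_def)
    then have "\<bar>w ! a\<bar> = 2 * i" "\<bar>w ! b\<bar> = 2 * i - 1"
      using assms(1) by (auto simp: abs_swap_pair split: if_splits)
    with ab pu[of b] qu[of a] show "q < p" by simp
  next
    assume "q < p"
    with p q assms(1) show "ordered_pair i (map (swap_pair i) w)"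
      unfolding ordered_pair_def by (intro exI[of _ q] exI[of _ p]) (simp add: abs_swap_pair)
  qed
  moreover have "p \<noteq> q" using p q by auto
  ultimately show ?thesis by auto
qed

lemma ordered_pair_swap_other:
  assumes "1 \<le> i" "i \<noteq> j"
  shows "ordered_pair j (map (swap_pair i) w) \<longleftrightarrow> ordered_pair j w"
proof -
  have "\<bar>swap_pair i x\<bar> = 2 * j - 1 \<longleftrightarrow> \<bar>x\<bar> = 2 * j - 1" "\<bar>swap_pair i x\<bar> = 2 * j \<longleftrightarrow> \<bar>x\<bar> = 2 * j" for x
    using assms by (auto simp: abs_swap_pair)
  then show ?thesis unfolding ordered_pair_def by (auto cong: conj_cong)
qed

text \<open>The exchange moves only letters of absolute value $2i-1$ or $2i$, so a letter of any other absolute value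
is fixed by it and is the image of itself alone.\<close>

lemma joined_pair_swap_other:
  assumes "1 \<le> i" "1 \<le> j" "i \<noteq> j"
  shows "joined_pair j (map (swap_pair i) w) \<longleftrightarrow> joined_pair j w"
proof -
  have abs_eq: "\<bar>swap_pair i x\<bar> = 2 * j - 1 \<longleftrightarrow> \<bar>x\<bar> = 2 * j - 1" for x
    using assms by (auto simp: abs_swap_pair)
  have fixed: "swap_pair i x = z \<longleftrightarrow> x = z" if z: "\<bar>z\<bar> = 2 * j - 1 \<or> \<bar>z\<bar> = 2 * j" for x z
  proof -
    have "\<bar>z\<bar> \<noteq> 2 * i - 1" "\<bar>z\<bar> \<noteq> 2 * i"
      using assms(3) z by auto
    then have "swap_pair i z = z" by (simp add: swap_pair_def)
    then show ?thesis
      using swap_pair_swap_pair[OF assms(1)] by metis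
  qed
  have "\<bar>swap_pair i x\<bar> = 2 * j - 1 \<and> swap_pair i y = swap_pair i x + sgn (swap_pair i x)
      \<longleftrightarrow> \<bar>x\<bar> = 2 * j - 1 \<and> y = x + sgn x" for x y
  proof (cases "\<bar>x\<bar> = 2 * j - 1")
    case True
    then have "\<bar>x + sgn x\<bar> = 2 * j" using assms(2) by (auto simp: sgn_if)
    then show ?thesis
      using True fixed[of x x] fixed[of "x + sgn x" y] by simp
  qed (simp add: abs_eq)
  then show ?thesis unfolding joined_pair_def by (auto cong: conj_cong)
qed

lemma joined_pair_imp_ordered:
  assumes "1 \<le> i" "joined_pair i w"
  shows "ordered_pair i w"
proof -
  obtain p where "Suc p < length w" "\<bar>w ! p\<bar> = 2 * i - 1" "w ! Suc p = w ! p + sgn (w ! p)"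
    using assms(2) by (auto simp: joined_pair_def)
  with assms(1) show ?thesis
    unfolding ordered_pair_def
    by (intro exI[of _ p] exI[of _ "Suc p"]) (auto simp: sgn_if)
qed

text \<open>Every absolute value other than $2i-1$ and $2i$ lies below both or above both, so the only comparison
that changes is that of the pair itself.\<close>

lemma inv_num_swap:
  assumes "1 \<le> i" "w \<in> signed_perms N" "ordered_pair i w"
  shows "inv_num (map abs (map (swap_pair i) w)) = Suc (inv_num (map abs w))"
proof -
  obtain p q where pq: "p < q" "q < length w" "\<bar>w ! p\<bar> = 2 * i - 1" "\<bar>w ! q\<bar> = 2 * i"
    using assms(3) by (auto simp: ordered_pair_def)
  have pu: "p' = p" if "p' < length w" "\<bar>w ! p'\<bar> = 2 * i - 1" for p'
    using signed_perms_abs_eq[OF assms(2) that(1), of p] that pq by simp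
  have qu: "q' = q" if "q' < length w" "\<bar>w ! q'\<bar> = 2 * i" for q'
    using signed_perms_abs_eq[OF assms(2) that(1), of q] that pq by simp
  let ?I = "\<lambda>w::int list. {(i, j). i < j \<and> j < length w \<and> w ! j < w ! i}"
  have fin: "finite (?I (map abs w))"
    by (rule finite_subset[of _ "{..<length w} \<times> {..<length w}"]) auto
  have less: "\<bar>swap_pair i (w ! b)\<bar> < \<bar>swap_pair i (w ! a)\<bar> \<longleftrightarrow> \<bar>w ! b\<bar> < \<bar>w ! a\<bar> \<or> (a, b) = (p, q)"
    if "a < b" "b < length w" for a b
  proof (cases "a = p \<and> b = q")
    case True
    then show ?thesis using assms(1) pq by (simp add: abs_swap_pair)
  next
    case False
    have "\<not> (\<bar>w ! a\<bar> = 2 * i - 1 \<and> \<bar>w ! b\<bar> = 2 * i)" using False pu[of a] qu[of b] that by auto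
    moreover have "\<not> (\<bar>w ! a\<bar> = 2 * i \<and> \<bar>w ! b\<bar> = 2 * i - 1)"
      using pq pu[of b] qu[of a] that by auto
    moreover have "\<bar>w ! a\<bar> \<noteq> \<bar>w ! b\<bar>"
      using signed_perms_abs_eq[OF assms(2), of a b] that by auto
    ultimately show ?thesis using False assms(1) by (auto simp: abs_swap_pair)
  qed
  have "?I (map abs (map (swap_pair i) w)) = insert (p, q) (?I (map abs w))"
    using pq(1,2) by (auto simp: less)
  moreover have "(p, q) \<notin> ?I (map abs w)" using pq by simp
  ultimately show ?thesis
    unfolding inv_num_index using fin by simp
qed

text \<open>For letters of different signs the order depends on the signs alone; so a change of letters that keeps
signs need only be checked for letters of equal sign.\<close>

lemma less_F_cong:
  assumes "sgn a = sgn a'" "sgn b = sgn b'"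
    and "sgn a = sgn b \<Longrightarrow> \<bar>a\<bar> < \<bar>b\<bar> \<longleftrightarrow> \<bar>a'\<bar> < \<bar>b'\<bar>"
  shows "less_F a b \<longleftrightarrow> less_F a' b'"
proof -
  have "a < 0 \<longleftrightarrow> a' < 0" "b > 0 \<longleftrightarrow> b' > 0"
    using assms(1,2) by (metis sgn_less, metis sgn_greater)
  then show ?thesis using assms unfolding less_F_def by auto
qed

lemma eq_add_sgn_iff:
  fixes x y :: int
  assumes "x \<noteq> 0"
  shows "y = x + sgn x \<longleftrightarrow> sgn y = sgn x \<and> \<bar>y\<bar> = \<bar>x\<bar> + 1"
  using assms by (cases "x > 0"; cases "y > 0"; cases "y = 0") auto

lemma less_F_swap_pair:
  assumes "1 \<le> i" "\<bar>x\<bar> \<noteq> \<bar>y\<bar>"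
    and "\<not> (\<bar>x\<bar> = 2 * i - 1 \<and> y = x + sgn x)" "\<not> (\<bar>y\<bar> = 2 * i - 1 \<and> x = y + sgn y)"
  shows "less_F (swap_pair i y) (swap_pair i x) \<longleftrightarrow> less_F y x"
proof (rule less_F_cong)
  assume "sgn (swap_pair i y) = sgn (swap_pair i x)"
  then have sgn: "sgn y = sgn x" using assms(1) by (simp add: sgn_swap_pair)
  have "\<not> (\<bar>x\<bar> = 2 * i - 1 \<and> \<bar>y\<bar> = 2 * i)" "\<not> (\<bar>y\<bar> = 2 * i - 1 \<and> \<bar>x\<bar> = 2 * i)"
    using assms(1,3,4) sgn eq_add_sgn_iff[of x y] eq_add_sgn_iff[of y x] by auto
  then show "\<bar>swap_pair i y\<bar> < \<bar>swap_pair i x\<bar> \<longleftrightarrow> \<bar>y\<bar> < \<bar>x\<bar>"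
    using assms(1,2) by (auto simp: abs_swap_pair)
qed (use assms(1) in \<open>simp_all add: sgn_swap_pair\<close>)

text \<open>The only comparison of neighbours that an exchange can affect is the one between the two letters
of the pair when they are neighbours of equal sign: for different signs the order does not look at the
absolute values. The sign of the first letter is unchanged.\<close>

lemma fdes_swap:
  assumes "1 \<le> i" "w \<in> signed_perms N" "N \<ge> 1" "ordered_pair i w"
  shows "fdes (map (swap_pair i) w) = (if joined_pair i w then fdes w + 2 else fdes w)"
proof -
  have len: "length w = N" using assms(2) by (rule signed_perms_length)
  obtain p q where pq: "p < q" "q < length w" "\<bar>w ! p\<bar> = 2 * i - 1" "\<bar>w ! q\<bar> = 2 * i"
    using assms(4) by (auto simp: ordered_pair_def)
  have pu: "p' = p" if "p' < length w" "\<bar>w ! p'\<bar> = 2 * i - 1" for p'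
    using signed_perms_abs_eq[OF assms(2) that(1), of p] that pq by simp
  have qu: "q' = q" if "q' < length w" "\<bar>w ! q'\<bar> = 2 * i" for q'
    using signed_perms_abs_eq[OF assms(2) that(1), of q] that pq by simp
  let ?w' = "map (swap_pair i) w"
  let ?D = "\<lambda>w. {i. Suc i < length w \<and> less_F (w ! Suc i) (w ! i)}"
  have fin: "finite (?D w)"
    by (rule finite_subset[of _ "{..<length w}"]) auto
  \<comment> \<open>a joined pair in decreasing order would contradict the order of the two positions\<close>
  have no_rev: "\<not> (\<bar>w ! Suc a\<bar> = 2 * i - 1 \<and> w ! a = w ! Suc a + sgn (w ! Suc a))"
    if "Suc a < length w" for a
  proof
    assume a: "\<bar>w ! Suc a\<bar> = 2 * i - 1 \<and> w ! a = w ! Suc a + sgn (w ! Suc a)"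
    then have "\<bar>w ! a\<bar> = 2 * i" using assms(1) by (auto simp: sgn_if)
    with a have "Suc a = p" "a = q" using pu qu that by auto
    with pq show False by simp
  qed
  have distinct: "\<bar>w ! a\<bar> \<noteq> \<bar>w ! Suc a\<bar>" if "Suc a < length w" for a
    using signed_perms_abs_eq[OF assms(2), of a "Suc a"] that by auto
  have "des_F ?w' = (if joined_pair i w then Suc (des_F w) else des_F w)"
  proof (cases "joined_pair i w")
    case True
    then have P: "Suc p < length w" "w ! Suc p = w ! p + sgn (w ! p)"
      using pu Suc_lessD by (metis joined_pair_def)+
    have P': "sgn (w ! Suc p) = sgn (w ! p)" "\<bar>w ! Suc p\<bar> = 2 * i"
      using P(2) pq(3) assms(1) eq_add_sgn_iff[of "w ! p" "w ! Suc p"] by auto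
    have "?D ?w' = insert p (?D w)"
    proof -
      have "less_F (swap_pair i (w ! Suc p)) (swap_pair i (w ! p))"
        using P' pq(3) assms(1) by (simp add: less_F_def abs_swap_pair sgn_swap_pair)
      moreover have "less_F (swap_pair i (w ! Suc a)) (swap_pair i (w ! a)) \<longleftrightarrow> less_F (w ! Suc a) (w ! a)"
        if "Suc a < length w" "a \<noteq> p" for a
        using that assms(1) no_rev distinct pu[of a] by (intro less_F_swap_pair) auto
      ultimately have "less_F (swap_pair i (w ! Suc a)) (swap_pair i (w ! a))
          \<longleftrightarrow> a = p \<or> less_F (w ! Suc a) (w ! a)" if "Suc a < length w" for a
        using that by blast
      then show ?thesis using P(1) by auto
    qed
    moreover have "p \<notin> ?D w"
      using P' pq(3) by (auto simp: less_F_def)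
    ultimately show ?thesis using True fin by (simp add: des_F_index)
  next
    case False
    have "less_F (swap_pair i (w ! Suc a)) (swap_pair i (w ! a)) \<longleftrightarrow> less_F (w ! Suc a) (w ! a)"
      if "Suc a < length w" for a
    proof (rule less_F_swap_pair[OF assms(1) distinct[OF that] _ no_rev[OF that]])
      show "\<not> (\<bar>w ! a\<bar> = 2 * i - 1 \<and> w ! Suc a = w ! a + sgn (w ! a))"
        using False that unfolding joined_pair_def by blast
    qed
    then have "?D ?w' = ?D w" by auto
    then show ?thesis using False by (simp add: des_F_index)
  qed
  moreover have "?w' ! 0 < 0 \<longleftrightarrow> w ! 0 < 0"
    using len assms by (simp add: swap_pair_neg_iff)
  ultimately show ?thesis by (simp add: fdes_def)
qed

lemma swap_pair_restricted_perms:
  assumes "1 \<le> i" "2 * i \<le> int (length S)" "w \<in> restricted_perms S"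
  shows "map (swap_pair i) w \<in> restricted_perms S"
proof -
  have "sign_of (swap_pair i x) = sign_of x" for x
    using assms(1) by (simp add: sign_of_def swap_pair_neg_iff)
  then show ?thesis
    using assms swap_pair_signed_perms[OF assms(1,2)]
    by (auto simp: restricted_perms_def signed_perms_length)
qed

section \<open>Reduction to words all of whose pairs are joined\<close>

text \<open>A pair that is ordered but not joined contributes the factor $1 + (-1) = 0$, a joined pair
contributes $1 - t^2$.\<close>

lemma signed_sum_eq_joined_sum:
  fixes t :: "'r::comm_ring_1"
  assumes "length H = 2 * n + 1"
  shows "(\<Sum>w\<in>restricted_perms H. (-1) ^ inv_num (map abs w) * t ^ fdes w)
    = (1 - t\<^sup>2) ^ n * (\<Sum>w | w \<in> restricted_perms H \<and> (\<forall>i\<in>{1..int n}. joined_pair i w).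
        (-1) ^ inv_num (map abs w) * t ^ fdes w)"
proof -
  define f where "f w = (-1) ^ inv_num (map abs w) * t ^ fdes w" for w
  define c where "c i w = (if joined_pair i w then - t\<^sup>2 else - 1)" for i w
  let ?X = "restricted_perms H" and ?I = "{1..int n}"
  have X: "w \<in> signed_perms (2 * n + 1)" if "w \<in> ?X" for w
    using that assms by (simp add: restricted_perms_def)
  have fin: "finite ?X"
    by (rule finite_subset[OF _ finite_signed_perms[of "2 * n + 1"]]) (use X in blast)
  have "(\<Sum>w\<in>?X. f w)
      = (\<Sum>w | w \<in> ?X \<and> (\<forall>i\<in>?I. ordered_pair i w). f w * (\<Prod>i\<in>?I. 1 + c i w))"
  proof (rule sum_involutions_product[where \<sigma> = "\<lambda>i. map (swap_pair i)"])
    fix i w assume i: "i \<in> ?I" and w: "w \<in> ?X"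
    show "map (swap_pair i) w \<in> ?X"
      using i w assms by (intro swap_pair_restricted_perms) auto
    show "map (swap_pair i) (map (swap_pair i) w) = w"
      using i by (simp add: swap_pair_swap_pair o_def)
    show "ordered_pair i (map (swap_pair i) w) \<longleftrightarrow> \<not> ordered_pair i w"
      using i X[OF w] by (intro ordered_pair_swap_same) auto
    show "f (map (swap_pair i) w) = c i w * f w" if "ordered_pair i w"
      using i X[OF w] that inv_num_swap[of i w "2 * n + 1"] fdes_swap[of i w "2 * n + 1"]
      by (simp add: f_def c_def power_add power2_eq_square algebra_simps)
  next
    fix i j w assume "i \<in> ?I" "j \<in> ?I" "i \<noteq> j"
    then show "ordered_pair j (map (swap_pair i) w) \<longleftrightarrow> ordered_pair j w"
      "c j (map (swap_pair i) w) = c j w"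
      by (auto simp: ordered_pair_swap_other joined_pair_swap_other c_def)
  qed (use fin in auto)
  also have "\<dots> = (\<Sum>w | w \<in> ?X \<and> (\<forall>i\<in>?I. joined_pair i w). f w * (\<Prod>i\<in>?I. 1 + c i w))"
  proof (rule sum.mono_neutral_right)
    show "\<forall>w\<in>{w \<in> ?X. \<forall>i\<in>?I. ordered_pair i w} - {w \<in> ?X. \<forall>i\<in>?I. joined_pair i w}.
        f w * (\<Prod>i\<in>?I. 1 + c i w) = 0"
    proof
      fix w assume "w \<in> {w \<in> ?X. \<forall>i\<in>?I. ordered_pair i w} - {w \<in> ?X. \<forall>i\<in>?I. joined_pair i w}"
      then obtain i where "i \<in> ?I" "\<not> joined_pair i w" by blast
      then have "(\<Prod>i\<in>?I. 1 + c i w) = 0"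
        by (intro prod_zero) (auto simp: c_def)
      then show "f w * (\<Prod>i\<in>?I. 1 + c i w) = 0" by simp
    qed
  qed (use fin in \<open>auto intro: joined_pair_imp_ordered\<close>)
  also have "\<dots> = (\<Sum>w | w \<in> ?X \<and> (\<forall>i\<in>?I. joined_pair i w). (1 - t\<^sup>2) ^ n * f w)"
    by (intro sum.cong refl) (auto simp: c_def mult.commute)
  finally show ?thesis
    by (simp add: f_def sum_distrib_left)
qed

section \<open>Doubling the letters of a word\<close>

text \<open>The parameter \<open>M\<close> is the largest absolute value of the word to be doubled. With $s$ the sign of $x$, the letter $x$ becomes
$s(2|x|-1)$ followed by $s\,2|x|$; the letter of absolute value \<open>M\<close> becomes $s(2M-1)$ alone.\<close>

definition double_letter :: "int \<Rightarrow> int \<Rightarrow> int list" where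
  "double_letter M x = (2 * x - sgn x) # (if \<bar>x\<bar> = M then [] else [2 * x])"

definition double_word :: "int \<Rightarrow> int list \<Rightarrow> int list" where
  "double_word M u = concat (map (double_letter M) u)"

definition half_letter :: "int \<Rightarrow> int" where
  "half_letter x = sgn x * ((\<bar>x\<bar> + 1) div 2)"

text \<open>In a doubled word the odd letters are the first letters of the blocks, one for each letter of the
original word.\<close>

definition halve_word :: "int list \<Rightarrow> int list" where
  "halve_word w = map half_letter (filter odd w)"

lemma double_word_simps [simp]:
  "double_word M [] = []"
  "double_word M (x # u) = double_letter M x @ double_word M u"
  "double_word M (u @ v) = double_word M u @ double_word M v"
  by (simp_all add: double_word_def)

lemma odd_sgn: "x \<noteq> 0 \<Longrightarrow> odd (sgn x)" for x :: int
  by (auto simp: sgn_if)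

lemma abs_double_minus_sgn: "x \<noteq> 0 \<Longrightarrow> \<bar>2 * x - sgn x\<bar> = 2 * \<bar>x\<bar> - 1" for x :: int
  by (auto simp: sgn_if)

lemma sgn_double_minus_sgn: "sgn (2 * x - sgn x) = sgn x" for x :: int
  by (auto simp: sgn_if)

lemma half_letter_double: "x \<noteq> 0 \<Longrightarrow> half_letter (2 * x - sgn x) = x"
  by (simp add: half_letter_def abs_double_minus_sgn sgn_double_minus_sgn sgn_mult_abs)

lemma halve_double_word: "0 \<notin> set u \<Longrightarrow> halve_word (double_word M u) = u"
proof (induction u)
  case (Cons x u)
  then show ?case
    by (auto simp: halve_word_def double_letter_def odd_sgn half_letter_double)
qed (simp add: halve_word_def)

lemma abs_set_double_word:
  assumes "0 \<notin> set u"
  shows "abs ` set (double_word M u) = (\<Union>v\<in>abs ` set u. {2 * v - 1} \<union> (if v = M then {} else {2 * v}))"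
  using assms
proof (induction u)
  case (Cons x u)
  have "abs ` set (double_letter M x) = {2 * \<bar>x\<bar> - 1} \<union> (if \<bar>x\<bar> = M then {} else {2 * \<bar>x\<bar>})"
    using Cons.prems by (auto simp: double_letter_def abs_double_minus_sgn)
  with Cons show ?case by (simp add: image_Un)
qed simp

lemma length_double_word:
  "M \<notin> abs ` set u \<Longrightarrow> length (double_word M u) = 2 * length u"
  by (induction u) (auto simp: double_letter_def)

text \<open>There is no descent inside a block. Between consecutive blocks, the last letter of one is
compared with the first letter of the next, and blocks are compared as the letters they come from.\<close>

lemma des_F_double_word:
  assumes "0 \<notin> set u" "distinct (map abs u)"
  shows "des_F (double_word M u) = des_F u"
  using assms
proof (induction u rule: induct_list012)
  case 1
  then show ?case by simp
next
  case (2 x)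
  then show ?case
    by (auto simp: double_letter_def des_F_Cons2 less_F_def sgn_if)
next
  case (3 x y u)
  have nz: "x \<noteq> 0" "y \<noteq> 0" "\<bar>x\<bar> \<noteq> \<bar>y\<bar>" using "3.prems" by auto
  obtain r where r: "double_word M (y # u) = (2 * y - sgn y) # r"
    by (simp add: double_letter_def)
  have IH: "des_F ((2 * y - sgn y) # r) = des_F (y # u)"
    using 3 by (simp only: r[symmetric]) simp
  have "less_F (2 * y - sgn y) (2 * x - sgn x) \<longleftrightarrow> less_F y x"
    using abs_double_minus_sgn[OF nz(1)] abs_double_minus_sgn[OF nz(2)]
    by (intro less_F_cong sgn_double_minus_sgn) linarith
  moreover have "less_F (2 * y - sgn y) (2 * x) \<longleftrightarrow> less_F y x"
  proof (rule less_F_cong)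
    show "\<bar>2 * y - sgn y\<bar> < \<bar>2 * x\<bar> \<longleftrightarrow> \<bar>y\<bar> < \<bar>x\<bar>"
      using nz(3) abs_double_minus_sgn[OF nz(2)] by linarith
  qed (simp_all add: sgn_double_minus_sgn sgn_mult)
  moreover have "\<not> less_F (2 * x) (2 * x - sgn x)"
    using nz by (auto simp: less_F_def sgn_if)
  moreover have "double_word M (x # y # u) = double_letter M x @ (2 * y - sgn y) # r"
    using r by simp
  ultimately show ?case
    using IH by (simp add: double_letter_def des_F_Cons2)
qed

text \<open>The two letters of a block form no inversion with each other and equally many inversions with the
letters to their right. The single letter $2M-1$ exceeds all letters to its right, and these
form complete blocks, hence are even in number.\<close>

lemma even_inv_num_double_word:
  assumes "\<forall>x\<in>set u. 1 \<le> \<bar>x\<bar> \<and> \<bar>x\<bar> \<le> M" "distinct (map abs u)"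
  shows "even (inv_num (map abs (double_word M u)))"
  using assms
proof (induction u)
  case Nil
  then show ?case by simp
next
  case (Cons x u)
  let ?v = "map abs (double_word M u)"
  have IH: "even (inv_num ?v)" using Cons by simp
  have nz: "x \<noteq> 0" "0 \<notin> set u" using Cons.prems(1) by auto
  have letters: "\<exists>y\<in>set u. a = 2 * \<bar>y\<bar> - 1 \<or> a = 2 * \<bar>y\<bar>" if "a \<in> set ?v" for a
  proof -
    have "a \<in> abs ` set (double_word M u)" using that by simp
    then show ?thesis
      unfolding abs_set_double_word[OF nz(2)] by (auto split: if_splits)
  qed
  have ne: "\<bar>y\<bar> \<noteq> \<bar>x\<bar>" if "y \<in> set u" for y
    using Cons.prems(2) that by (auto simp: image_iff)
  show ?case
  proof (cases "\<bar>x\<bar> = M")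
    case True
    have lt: "\<bar>y\<bar> < M" if "y \<in> set u" for y
      using Cons.prems(1) ne[OF that] that True by (auto simp: less_le)
    have "filter (\<lambda>a. a < 2 * \<bar>x\<bar> - 1) ?v = ?v"
      unfolding filter_id_conv using letters lt True by fastforce
    moreover have "M \<notin> abs ` set u" using lt by auto
    ultimately show ?thesis
      using IH True nz by (simp add: double_letter_def inv_num_Cons abs_double_minus_sgn length_double_word)
  next
    case False
    have "filter (\<lambda>a. a < 2 * \<bar>x\<bar>) ?v = filter (\<lambda>a. a < 2 * \<bar>x\<bar> - 1) ?v"
    proof (rule filter_cong[OF refl])
      fix a assume "a \<in> set ?v"
      then obtain y where y: "y \<in> set u" "a = 2 * \<bar>y\<bar> - 1 \<or> a = 2 * \<bar>y\<bar>" using letters by blast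
      from y(2) ne[OF y(1)] show "a < 2 * \<bar>x\<bar> \<longleftrightarrow> a < 2 * \<bar>x\<bar> - 1" by presburger
    qed
    moreover have "map abs (double_word M (x # u)) = (2 * \<bar>x\<bar> - 1) # 2 * \<bar>x\<bar> # ?v"
      using False nz by (simp add: double_letter_def abs_double_minus_sgn abs_mult)
    ultimately show ?thesis
      using IH by (simp only: inv_num_Cons) simp
  qed
qed

lemma signed_perms_letters:
  assumes "u \<in> signed_perms N"
  shows "\<forall>x\<in>set u. 1 \<le> \<bar>x\<bar> \<and> \<bar>x\<bar> \<le> int N" "0 \<notin> set u" "distinct (map abs u)"
proof -
  have "abs ` set u = {1..int N}" using assms by (simp add: signed_perms_iff)
  then show *: "\<forall>x\<in>set u. 1 \<le> \<bar>x\<bar> \<and> \<bar>x\<bar> \<le> int N" by (metis atLeastAtMost_iff imageI)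
  then show "0 \<notin> set u" by auto
qed (use assms in \<open>simp add: signed_perms_iff\<close>)

lemma signed_perms_split_max:
  assumes "u \<in> signed_perms N" "k < N" "\<bar>u ! k\<bar> = int N"
  shows "u = take k u @ u ! k # drop (Suc k) u"
    "int N \<notin> abs ` set (take k u)" "int N \<notin> abs ` set (drop (Suc k) u)"
proof -
  have len: "length u = N" using assms(1) by (rule signed_perms_length)
  then show eq: "u = take k u @ u ! k # drop (Suc k) u"
    using assms(2) by (simp add: id_take_nth_drop)
  have "distinct (map abs (take k u @ u ! k # drop (Suc k) u))"
    using signed_perms_letters(3)[OF assms(1)] eq by simp
  then show "int N \<notin> abs ` set (take k u)" "int N \<notin> abs ` set (drop (Suc k) u)"
    using assms(3) by (auto simp del: set_map simp: set_map[symmetric])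
qed

text \<open>The length is odd because one letter, that of absolute value $n+1$, is not doubled; since the
absolute values fill $\{1,\dots,2n+1\}$ and the length agrees, they are distinct.\<close>

lemma double_word_signed_perms:
  assumes "u \<in> signed_perms (n + 1)"
  shows "double_word (int n + 1) u \<in> signed_perms (2 * n + 1)"
proof -
  let ?w = "double_word (int n + 1) u"
  obtain k where k: "k < length u" "\<bar>u ! k\<bar> = int n + 1"
    by (rule signed_perms_abs_occurs[OF assms, of "int n + 1"]) auto
  have len: "length u = n + 1" using assms by (rule signed_perms_length)
  note split = signed_perms_split_max[OF assms, of k]
  have "length ?w = length (double_word (int n + 1) (take k u @ u ! k # drop (Suc k) u))"
    using split(1) k len by simp
  also have "\<dots> = 2 * n + 1"
    using split(2,3) k len by (simp add: double_letter_def length_double_word add.commute)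
  finally have length: "length ?w = 2 * n + 1" .
  have "abs ` set u = {1..int n + 1}" using assms by (simp add: signed_perms_iff)
  then have "abs ` set ?w = (\<Union>v\<in>{1..int n + 1}. {2 * v - 1} \<union> (if v = int n + 1 then {} else {2 * v}))"
    using abs_set_double_word[OF signed_perms_letters(2)[OF assms]] by simp
  also have "\<dots> = {1..2 * int n + 1}"
  proof (intro equalityI subsetI)
    fix z assume z: "z \<in> {1..2 * int n + 1}"
    show "z \<in> (\<Union>v\<in>{1..int n + 1}. {2 * v - 1} \<union> (if v = int n + 1 then {} else {2 * v}))"
    proof (rule UN_I[of "(z + 1) div 2"])
      show "(z + 1) div 2 \<in> {1..int n + 1}" using z by auto
      have "z = 2 * ((z + 1) div 2) - 1 \<or> z = 2 * ((z + 1) div 2)" by presburger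
      then show "z \<in> {2 * ((z + 1) div 2) - 1} \<union>
          (if (z + 1) div 2 = int n + 1 then {} else {2 * ((z + 1) div 2)})"
        using z by auto
    qed
  qed (auto split: if_splits)
  finally have set: "abs ` set ?w = {1..int (2 * n + 1)}" by simp
  then have "distinct (map abs ?w)"
    using length by (intro card_distinct) simp
  with set show ?thesis by (simp add: signed_perms_iff)
qed

lemma joined_pair_double_word:
  assumes "u \<in> signed_perms (n + 1)" "i \<in> {1..int n}"
  shows "joined_pair i (double_word (int n + 1) u)"
proof -
  obtain k where k: "k < length u" "\<bar>u ! k\<bar> = i"
    by (rule signed_perms_abs_occurs[OF assms(1), of i]) (use assms(2) in auto)
  define x a c where "x = u ! k" and "a = take k u" and "c = drop (Suc k) u"
  have x: "\<bar>x\<bar> = i" "x \<noteq> 0" "\<bar>x\<bar> \<noteq> int n + 1" using k assms(2) by (auto simp: x_def)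
  have "u = a @ x # c" using k by (simp add: x_def a_def c_def id_take_nth_drop)
  then have "double_word (int n + 1) u
      = double_word (int n + 1) a @ (2 * x - sgn x) # 2 * x # double_word (int n + 1) c"
    using x by (simp add: double_letter_def)
  then show ?thesis
    unfolding joined_pair_def using x
    by (intro exI[of _ "length (double_word (int n + 1) a)"])
      (simp add: nth_append abs_double_minus_sgn sgn_double_minus_sgn)
qed

text \<open>The hypotheses say that the word can be read from left to right in blocks: an odd letter is either
the single letter of absolute value $2M-1$ or is followed by its partner, and an even letter never starts a block.\<close>

lemma double_halve_word:
  assumes odd: "\<And>p. p < length w \<Longrightarrow> odd (w ! p) \<Longrightarrow>
      \<bar>w ! p\<bar> = 2 * M - 1 \<or> Suc p < length w \<and> w ! Suc p = w ! p + sgn (w ! p)"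
    and even: "\<And>p. p < length w \<Longrightarrow> even (w ! p) \<Longrightarrow>
      \<exists>q. p = Suc q \<and> odd (w ! q) \<and> \<bar>w ! q\<bar> \<noteq> 2 * M - 1"
  shows "double_word M (halve_word w) = w"
  using assms
proof (induction w rule: length_induct)
  case (1 w)
  note odd = "1.prems"(1) and even = "1.prems"(2)
  show ?case
  proof (cases w)
    case Nil
    then show ?thesis by (simp add: halve_word_def)
  next
    case w: (Cons x w')
    have ox: "odd x" using even[of 0] w by auto
    then have half: "2 * half_letter x - sgn (half_letter x) = x"
      "\<bar>half_letter x\<bar> = M \<longleftrightarrow> \<bar>x\<bar> = 2 * M - 1" "2 * half_letter x = x + sgn x"
    proof -
      define m where "m = (\<bar>x\<bar> + 1) div 2"
      have "odd \<bar>x\<bar>" using ox by simp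
      then have m: "\<bar>x\<bar> = 2 * m - 1" unfolding m_def by presburger
      have h: "half_letter x = sgn x * m" by (simp add: half_letter_def m_def)
      have "x \<noteq> 0" using ox by auto
      moreover have "m \<ge> 1" "x = 2 * m - 1 \<or> x = 1 - 2 * m" using m by linarith+
      ultimately show "2 * half_letter x - sgn (half_letter x) = x"
        "\<bar>half_letter x\<bar> = M \<longleftrightarrow> \<bar>x\<bar> = 2 * M - 1" "2 * half_letter x = x + sgn x"
        by (auto simp: h sgn_if)
    qed
    show ?thesis
    proof (cases "\<bar>x\<bar> = 2 * M - 1")
      case True
      have "double_word M (halve_word w') = w'"
      proof (rule "1.IH"[rule_format])
        fix p assume p: "p < length w'" "odd (w' ! p)"
        then show "\<bar>w' ! p\<bar> = 2 * M - 1 \<or> Suc p < length w' \<and> w' ! Suc p = w' ! p + sgn (w' ! p)"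
          using odd[of "Suc p"] w by simp
      next
        fix p assume p: "p < length w'" "even (w' ! p)"
        then obtain q where "p = q" "odd (w ! q)" "\<bar>w ! q\<bar> \<noteq> 2 * M - 1"
          using even[of "Suc p"] w by auto
        with True w show "\<exists>q. p = Suc q \<and> odd (w' ! q) \<and> \<bar>w' ! q\<bar> \<noteq> 2 * M - 1"
          by (cases q) auto
      qed (simp add: w)
      then show ?thesis
        using w ox half True by (simp add: halve_word_def double_letter_def)
    next
      case False
      then obtain w'' where w': "w' = (x + sgn x) # w''"
        using odd[of 0] ox w by (cases w') auto
      have ey: "even (x + sgn x)" using ox by (auto simp: sgn_if)
      have "double_word M (halve_word w'') = w''"
      proof (rule "1.IH"[rule_format])
        fix p assume p: "p < length w''" "odd (w'' ! p)"
        then show "\<bar>w'' ! p\<bar> = 2 * M - 1 \<or> Suc p < length w'' \<and> w'' ! Suc p = w'' ! p + sgn (w'' ! p)"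
          using odd[of "Suc (Suc p)"] w w' by simp
      next
        fix p assume p: "p < length w''" "even (w'' ! p)"
        then obtain q where q: "Suc p = q" "odd (w ! q)" "\<bar>w ! q\<bar> \<noteq> 2 * M - 1"
          using even[of "Suc (Suc p)"] w w' by auto
        with ey w w' show "\<exists>q. p = Suc q \<and> odd (w'' ! q) \<and> \<bar>w'' ! q\<bar> \<noteq> 2 * M - 1"
          by (cases p) auto
      qed (simp add: w w')
      then show ?thesis
        using w w' ox ey half False by (simp add: halve_word_def double_letter_def)
    qed
  qed
qed

text \<open>Halving is a bijection from the odd numbers in $\{1,\dots,2n+1\}$ onto $\{1,\dots,n+1\}$.\<close>

lemma halve_word_signed_perms:
  assumes "w \<in> signed_perms (2 * n + 1)"
  shows "halve_word w \<in> signed_perms (n + 1)"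
proof -
  let ?h = "\<lambda>v::int. (v + 1) div 2"
  have "\<bar>half_letter x\<bar> = ?h \<bar>x\<bar>" for x
    by (cases "x = 0") (simp_all add: half_letter_def abs_mult)
  then have eq: "map abs (halve_word w) = map ?h (filter odd (map abs w))"
    by (simp add: halve_word_def filter_map o_def)
  have w: "distinct (map abs w)" "abs ` set w = {1..2 * int n + 1}"
    using assms by (simp_all add: signed_perms_iff)
  have "inj_on ?h {v. odd v}"
    by (rule inj_onI) (auto elim!: oddE)
  then have "distinct (map ?h (filter odd (map abs w)))"
    using w(1) by (subst distinct_map) (auto intro: inj_on_subset)
  moreover have "set (map ?h (filter odd (map abs w))) = {1..int n + 1}"
  proof -
    have "set (map ?h (filter odd (map abs w))) = ?h ` {v \<in> {1..2 * int n + 1}. odd v}"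
      using w(2) by auto
    also have "\<dots> = {1..int n + 1}"
    proof (intro equalityI subsetI)
      fix z assume "z \<in> {1..int n + 1}"
      then have "2 * z - 1 \<in> {v \<in> {1..2 * int n + 1}. odd v}" "z = ?h (2 * z - 1)" by auto
      then show "z \<in> ?h ` {v \<in> {1..2 * int n + 1}. odd v}" by blast
    qed auto
    finally show ?thesis .
  qed
  ultimately show ?thesis
    unfolding signed_perms_def permutations_of_set_def by (simp only: eq mem_Collect_eq) simp
qed

lemma double_halve_joined:
  assumes w: "w \<in> signed_perms (2 * n + 1)" and joined: "\<forall>i\<in>{1..int n}. joined_pair i w"
  shows "double_word (int n + 1) (halve_word w) = w"
proof (rule double_halve_word)
  fix p assume p: "p < length w" "odd (w ! p)"
  have b: "1 \<le> \<bar>w ! p\<bar>" "\<bar>w ! p\<bar> \<le> 2 * int n + 1"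
    using signed_perms_letters(1)[OF w] nth_mem[OF p(1)] by auto
  show "\<bar>w ! p\<bar> = 2 * (int n + 1) - 1 \<or> Suc p < length w \<and> w ! Suc p = w ! p + sgn (w ! p)"
  proof (cases "\<bar>w ! p\<bar> = 2 * (int n + 1) - 1")
    case False
    define i where "i = (\<bar>w ! p\<bar> + 1) div 2"
    have i: "\<bar>w ! p\<bar> = 2 * i - 1" "i \<in> {1..int n}"
    proof -
      have "odd \<bar>w ! p\<bar>" using p(2) by simp
      then show "\<bar>w ! p\<bar> = 2 * i - 1" unfolding i_def by presburger
      with b False show "i \<in> {1..int n}" by auto
    qed
    obtain q where q: "Suc q < length w" "\<bar>w ! q\<bar> = 2 * i - 1" "w ! Suc q = w ! q + sgn (w ! q)"
      using joined[rule_format, OF i(2)] unfolding joined_pair_def by blast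
    then have "q = p" using signed_perms_abs_eq[OF w, of q p] i(1) p(1) by simp
    with q show ?thesis by simp
  qed simp
next
  fix p assume p: "p < length w" "even (w ! p)"
  have b: "1 \<le> \<bar>w ! p\<bar>" "\<bar>w ! p\<bar> \<le> 2 * int n + 1"
    using signed_perms_letters(1)[OF w] nth_mem[OF p(1)] by auto
  define i where "i = \<bar>w ! p\<bar> div 2"
  have i: "\<bar>w ! p\<bar> = 2 * i" "i \<in> {1..int n}"
  proof -
    have "even \<bar>w ! p\<bar>" using p(2) by simp
    then show "\<bar>w ! p\<bar> = 2 * i" unfolding i_def by presburger
    with b show "i \<in> {1..int n}" by auto
  qed
  obtain q where q: "Suc q < length w" "\<bar>w ! q\<bar> = 2 * i - 1" "w ! Suc q = w ! q + sgn (w ! q)"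
    using joined[rule_format, OF i(2)] unfolding joined_pair_def by blast
  have "w ! q \<noteq> 0" using q(2) i(2) by auto
  then have "\<bar>w ! Suc q\<bar> = 2 * i" using q eq_add_sgn_iff[of "w ! q" "w ! Suc q"] by simp
  then have "p = Suc q" using signed_perms_abs_eq[OF w, of "Suc q" p] i(1) p(1) q(1) by simp
  moreover have "odd \<bar>w ! q\<bar>" unfolding q(2) by simp
  then have "odd (w ! q)" by simp
  ultimately show "\<exists>q. p = Suc q \<and> odd (w ! q) \<and> \<bar>w ! q\<bar> \<noteq> 2 * (int n + 1) - 1"
    using q(2) i(2) by auto
qed

lemma fdes_double_word:
  assumes "u \<in> signed_perms (Suc N)"
  shows "fdes (double_word M u) = fdes u"
proof -
  obtain x u' where u: "u = x # u'"
    using signed_perms_length[OF assms] by (cases u) auto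
  have "2 * x - sgn x < 0 \<longleftrightarrow> x < 0" by (auto simp: sgn_if)
  then show ?thesis
    using des_F_double_word[OF signed_perms_letters(2,3)[OF assms], of M]
    by (simp add: fdes_def u double_letter_def)
qed

text \<open>Doubling and halving are inverse bijections between the short words and the words with all pairs
joined; the latter have sign $+1$.\<close>

lemma signed_sum_eq_double_word_sum:
  fixes t :: "'r::comm_ring_1"
  assumes "length H = 2 * n + 1"
  shows "(\<Sum>w\<in>restricted_perms H. (-1) ^ inv_num (map abs w) * t ^ fdes w)
    = (1 - t\<^sup>2) ^ n *
      (\<Sum>u | u \<in> signed_perms (n + 1) \<and> double_word (int n + 1) u \<in> restricted_perms H. t ^ fdes u)"
proof -
  let ?M = "int n + 1"
  have restricted: "w \<in> signed_perms (2 * n + 1)" if "w \<in> restricted_perms H" for w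
    using that assms by (simp add: restricted_perms_def)
  have "(\<Sum>w | w \<in> restricted_perms H \<and> (\<forall>i\<in>{1..int n}. joined_pair i w).
        (-1) ^ inv_num (map abs w) * t ^ fdes w)
      = (\<Sum>u | u \<in> signed_perms (n + 1) \<and> double_word ?M u \<in> restricted_perms H. t ^ fdes u)"
  proof (rule sum.reindex_bij_witness[of _ "double_word ?M" halve_word])
    fix w assume "w \<in> {w \<in> restricted_perms H. \<forall>i\<in>{1..int n}. joined_pair i w}"
    then have w: "w \<in> restricted_perms H" "w \<in> signed_perms (2 * n + 1)"
      "\<forall>i\<in>{1..int n}. joined_pair i w" using restricted by auto
    show dh: "double_word ?M (halve_word w) = w" using w by (intro double_halve_joined)
    show hw: "halve_word w \<in> {u \<in> signed_perms (n + 1). double_word ?M u \<in> restricted_perms H}"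
      using w dh halve_word_signed_perms by simp
    have u: "halve_word w \<in> signed_perms (n + 1)" using hw by simp
    have "even (inv_num (map abs (double_word ?M (halve_word w))))"
      using signed_perms_letters[OF u] by (intro even_inv_num_double_word) auto
    moreover have "fdes (double_word ?M (halve_word w)) = fdes (halve_word w)"
      using u by (intro fdes_double_word) simp
    ultimately show "t ^ fdes (halve_word w) = (-1) ^ inv_num (map abs w) * t ^ fdes w"
      by (simp add: dh)
  next
    fix u assume u: "u \<in> {u \<in> signed_perms (n + 1). double_word ?M u \<in> restricted_perms H}"
    then show "halve_word (double_word ?M u) = u"
      using signed_perms_letters(2) by (intro halve_double_word) blast
    show "double_word ?M u \<in> {w \<in> restricted_perms H. \<forall>i\<in>{1..int n}. joined_pair i w}"
      using u joined_pair_double_word by blast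
  qed
  then show ?thesis using signed_sum_eq_joined_sum[OF assms, of t] by simp
qed

section \<open>Signs and the position of the largest letter\<close>

lemma sign_of_double_letter:
  "sign_of (2 * x - sgn x) = sign_of x" "sign_of (2 * x) = sign_of x"
  by (auto simp: sign_of_def sgn_if)

lemma sign_of_double_word_nth:
  assumes "M \<notin> abs ` set u" "j < 2 * length u"
  shows "sign_of (double_word M u ! j) = sign_of (u ! (j div 2))"
  using assms
proof (induction u arbitrary: j)
  case (Cons x u)
  have word: "double_word M (x # u) = (2 * x - sgn x) # 2 * x # double_word M u"
    using Cons.prems(1) by (auto simp: double_letter_def)
  consider "j = 0" | "j = 1" | j' where "j = Suc (Suc j')"
    by (metis One_nat_def not0_implies_Suc)
  then show ?case
  proof cases
    case 3
    then show ?thesis using Cons word by simp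
  qed (simp_all only: word, simp_all add: sign_of_double_letter)
qed simp

text \<open>Positions count from $0$ here. Up to the single letter at position $2k$, the blocks start at even
positions; behind it they start at odd positions.\<close>

lemma sign_of_double_word_nth_max:
  assumes "u \<in> signed_perms (n + 1)" "k < n + 1" "\<bar>u ! k\<bar> = int n + 1" "j < 2 * n + 1"
  shows "sign_of (double_word (int n + 1) u ! j)
    = sign_of (u ! (if j \<le> 2 * k then j div 2 else (j + 1) div 2))"
proof -
  let ?M = "int n + 1"
  define x a c where "x = u ! k" and "a = take k u" and "c = drop (Suc k) u"
  have split: "u = a @ x # c" "?M \<notin> abs ` set a" "?M \<notin> abs ` set c" "\<bar>x\<bar> = ?M"
    using signed_perms_split_max[of u "n + 1" k] assms by (simp_all add: x_def a_def c_def add.commute)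
  have len: "length a = k" "length c = n - k"
    using assms(2) signed_perms_length[OF assms(1)] by (simp_all add: a_def c_def)
  have word: "double_word ?M u = double_word ?M a @ (2 * x - sgn x) # double_word ?M c"
    using split(4) by (simp add: split(1) double_letter_def)
  have lena: "length (double_word ?M a) = 2 * k" using length_double_word[OF split(2)] len by simp
  consider "j < 2 * k" | "j = 2 * k" | j' where "j = 2 * k + 1 + j'"
    by (metis less_imp_Suc_add linorder_neqE_nat add_Suc_right add.commute plus_1_eq_Suc)
  then show ?thesis
  proof cases
    case 1
    then have "sign_of (double_word ?M u ! j) = sign_of (a ! (j div 2))"
      using sign_of_double_word_nth[OF split(2)] len lena by (simp add: word nth_append)
    moreover have "j div 2 < k" using 1 by linarith
    ultimately show ?thesis using 1 len by (simp add: split(1) nth_append)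
  next
    case 2
    then have "sign_of (double_word ?M u ! j) = sign_of x"
      using lena by (simp add: word nth_append sign_of_double_letter)
    with 2 show ?thesis using len by (simp add: split(1) nth_append)
  next
    case 3
    then have "sign_of (double_word ?M u ! j) = sign_of (c ! (j' div 2))"
      using sign_of_double_word_nth[OF split(3), of j'] len lena assms(2,4) by (simp add: word nth_append)
    moreover have "(j + 1) div 2 = Suc (k + j' div 2)" using 3 by presburger
    ultimately show ?thesis using 3 len by (simp add: split(1) nth_append)
  qed
qed

lemma restricted_perms_iff:
  "w \<in> restricted_perms S \<longleftrightarrow>
    w \<in> signed_perms (length S) \<and> (\<forall>j<length S. sign_of (w ! j) \<in> S ! j)"
proof -
  have "(\<forall>i\<in>{1..N}. Q (i - 1)) \<longleftrightarrow> (\<forall>j<N. Q j)" for N and Q :: "nat \<Rightarrow> bool"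
    by (metis One_nat_def Suc_pred' atLeastAtMost_iff diff_Suc_1 less_eq_Suc_le zero_less_Suc Suc_le_eq)
  from this[of "length S" "\<lambda>j. sign_of (w ! j) \<in> S ! j"] show ?thesis
    by (auto simp: restricted_perms_def)
qed

text \<open>The marked tuple with its positions counted from $0$, as they are in the description of
\<open>double_word\<close> by positions; hence the mark at \<open>Suc k\<close>.\<close>

lemma mem_marked_perms_marked_tuple:
  "u \<in> marked_perms (marked_tuple n H (Suc k)) \<longleftrightarrow>
    u \<in> signed_perms (n + 1) \<and> \<bar>u ! k\<bar> = int n + 1 \<and>
    (\<forall>j<n + 1. sign_of (u ! j) \<in>
      (if j < k then H ! (2 * j) \<inter> H ! (2 * j + 1) else if j = k then H ! (2 * j)
       else H ! (2 * j - 1) \<inter> H ! (2 * j)))"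
proof -
  have "fst (marked_tuple n H (Suc k)) ! j =
      (if j < k then H ! (2 * j) \<inter> H ! (2 * j + 1) else if j = k then H ! (2 * j)
       else H ! (2 * j - 1) \<inter> H ! (2 * j))" if "j < n + 1" for j
    using that by (auto simp: marked_tuple_def simp del: upt_Suc)
  then show ?thesis
    by (auto simp: marked_tuple_def restricted_perms_iff add.commute simp del: upt_Suc)
qed

lemma double_word_restricted_iff_marked:
  assumes "length H = 2 * n + 1" "k < n + 1" "u \<in> signed_perms (n + 1)" "\<bar>u ! k\<bar> = int n + 1"
  shows "double_word (int n + 1) u \<in> restricted_perms H \<longleftrightarrow>
    u \<in> marked_perms (marked_tuple n H (Suc k))"
proof -
  let ?g = "\<lambda>j. if j \<le> 2 * k then j div 2 else (j + 1) div 2"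
  let ?S = "\<lambda>j. if j < k then H ! (2 * j) \<inter> H ! (2 * j + 1) else if j = k then H ! (2 * j)
       else H ! (2 * j - 1) \<inter> H ! (2 * j)"
  have "double_word (int n + 1) u \<in> restricted_perms H
      \<longleftrightarrow> (\<forall>j<2 * n + 1. sign_of (u ! ?g j) \<in> H ! j)"
    using assms double_word_signed_perms[OF assms(3)] sign_of_double_word_nth_max[OF assms(3,2,4)]
    by (simp add: restricted_perms_iff)
  also have "\<dots> \<longleftrightarrow> (\<forall>j<n + 1. sign_of (u ! j) \<in> ?S j)"
  proof (intro iffI allI impI)
    fix j assume *: "\<forall>j<2 * n + 1. sign_of (u ! ?g j) \<in> H ! j" and j: "j < n + 1"
    consider "j < k" | "j = k" | "j > k" by linarith
    then show "sign_of (u ! j) \<in> ?S j"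
    proof cases
      case 1
      then show ?thesis using *[rule_format, of "2 * j"] *[rule_format, of "2 * j + 1"] j assms(2) by simp
    next
      case 2
      then show ?thesis using *[rule_format, of "2 * j"] j by simp
    next
      case 3
      then have "?g (2 * j - 1) = j" "?g (2 * j) = j" by auto
      with 3 show ?thesis using *[rule_format, of "2 * j - 1"] *[rule_format, of "2 * j"] j by auto
    qed
  next
    fix j assume *: "\<forall>j<n + 1. sign_of (u ! j) \<in> ?S j" and j: "j < 2 * n + 1"
    have g: "?g j < n + 1" using j by auto
    have "?S (?g j) \<subseteq> H ! j"
    proof -
      have "j = 2 * (?g j) \<or> j = 2 * (?g j) + 1 \<and> ?g j < k \<or> j = 2 * (?g j) - 1 \<and> ?g j > k"
        by (auto; presburger)
      then show ?thesis by (elim disjE) (auto split: if_splits)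
    qed
    with *[rule_format, OF g] show "sign_of (u ! ?g j) \<in> H ! j" by blast
  qed
  finally show ?thesis
    using assms by (simp only: mem_marked_perms_marked_tuple) simp
qed

text \<open>The short words are sorted by the position of their letter of largest absolute value.\<close>

lemma sum_double_word_eq_sum_marked:
  fixes f :: "int list \<Rightarrow> 'r::comm_monoid_add"
  assumes "length H = 2 * n + 1"
  shows "(\<Sum>u | u \<in> signed_perms (n + 1) \<and> double_word (int n + 1) u \<in> restricted_perms H. f u)
    = (\<Sum>S\<in>marked_tuples n H. \<Sum>u\<in>marked_perms S. f u)"
proof -
  let ?T = "\<lambda>k. marked_tuple n H (Suc k)"
  have tuples: "marked_tuples n H = ?T ` {..<n + 1}"
    unfolding marked_tuples_def image_Suc_lessThan[symmetric] image_image
    by (simp add: lessThan_Suc_atMost atLeast0AtMost)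
  have inj: "inj_on ?T {..<n + 1}"
    by (rule inj_onI) (simp add: marked_tuple_def)
  have sub: "marked_perms (?T k) \<subseteq> signed_perms (n + 1)" for k
    by (auto simp: mem_marked_perms_marked_tuple)
  have "{u \<in> signed_perms (n + 1). double_word (int n + 1) u \<in> restricted_perms H}
      = (\<Union>k<n + 1. marked_perms (?T k))"
  proof (intro equalityI subsetI)
    fix u assume u: "u \<in> {u \<in> signed_perms (n + 1). double_word (int n + 1) u \<in> restricted_perms H}"
    then obtain k where k: "k < length u" "\<bar>u ! k\<bar> = int n + 1"
      using signed_perms_abs_occurs[of u "n + 1" "int n + 1"] by auto
    then have "k < n + 1" using u signed_perms_length by auto
    with u k show "u \<in> (\<Union>k<n + 1. marked_perms (?T k))"
      using double_word_restricted_iff_marked[OF assms, of k u] by blast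
  next
    fix u assume "u \<in> (\<Union>k<n + 1. marked_perms (?T k))"
    then obtain k where k: "k < n + 1" "u \<in> marked_perms (?T k)" by auto
    then have "u \<in> signed_perms (n + 1)" "\<bar>u ! k\<bar> = int n + 1"
      by (simp_all add: mem_marked_perms_marked_tuple)
    with k show "u \<in> {u \<in> signed_perms (n + 1). double_word (int n + 1) u \<in> restricted_perms H}"
      using double_word_restricted_iff_marked[OF assms, of k u] by blast
  qed
  also have "(\<Sum>u\<in>(\<Union>k<n + 1. marked_perms (?T k)). f u)
      = (\<Sum>k<n + 1. \<Sum>u\<in>marked_perms (?T k). f u)"
  proof (rule sum.UNION_disjoint)
    show "\<forall>k\<in>{..<n + 1}. finite (marked_perms (?T k))"
      using sub finite_signed_perms finite_subset by blast
    show "\<forall>k\<in>{..<n + 1}. \<forall>l\<in>{..<n + 1}. k \<noteq> l \<longrightarrow> marked_perms (?T k) \<inter> marked_perms (?T l) = {}"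
    proof (intro ballI impI)
      fix k l assume kl: "k \<in> {..<n + 1}" "l \<in> {..<n + 1}" "k \<noteq> l"
      show "marked_perms (?T k) \<inter> marked_perms (?T l) = {}"
      proof (rule ccontr)
        assume "\<not> ?thesis"
        then obtain u where u: "u \<in> signed_perms (n + 1)" "\<bar>u ! k\<bar> = int n + 1" "\<bar>u ! l\<bar> = int n + 1"
          by (auto simp: mem_marked_perms_marked_tuple)
        with kl signed_perms_abs_eq[OF u(1), of k l] signed_perms_length[OF u(1)] show False by simp
      qed
    qed
  qed simp
  also have "\<dots> = (\<Sum>S\<in>marked_tuples n H. \<Sum>u\<in>marked_perms S. f u)"
    by (simp only: tuples sum.reindex[OF inj] o_def)
  finally show ?thesis .
qed

theorem theorem3p2:
  fixes n :: nat and t :: "int poly"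
  assumes "n \<ge> 1"
  defines "t \<equiv> [:0, 1:]"
  shows "(\<forall>H :: psign set list. length H = 2*n + 1 \<and> (\<forall>i \<in> {1..2*n + 1}. H !\<^sub>1 i \<noteq> {}) \<longrightarrow>
            (\<Sum>\<pi>\<in>restricted_perms H. (-1) ^ inv_num (map abs \<pi>) * t ^ fdes \<pi>)
            = (1 - t\<^sup>2) ^ n *
              (\<Sum>S\<in>marked_tuples n H. \<Sum>\<pi>\<in>marked_perms S. t ^ fdes \<pi>))
       \<and> (\<Sum>\<pi>\<in>signed_perms (2*n + 1). (-1) ^ inv_num (map abs \<pi>) * t ^ fdes \<pi>)
         = (1 - t\<^sup>2) ^ n * (\<Sum>\<pi>\<in>signed_perms (n + 1). t ^ fdes \<pi>)"
proof (intro conjI allI impI)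
  fix H :: "psign set list"
  assume "length H = 2*n + 1 \<and> (\<forall>i \<in> {1..2*n + 1}. H !\<^sub>1 i \<noteq> {})"
  then have len: "length H = 2 * n + 1" by blast
  show "(\<Sum>\<pi>\<in>restricted_perms H. (-1) ^ inv_num (map abs \<pi>) * t ^ fdes \<pi>)
      = (1 - t\<^sup>2) ^ n * (\<Sum>S\<in>marked_tuples n H. \<Sum>\<pi>\<in>marked_perms S. t ^ fdes \<pi>)"
    unfolding signed_sum_eq_double_word_sum[OF len] sum_double_word_eq_sum_marked[OF len] ..
next
  \<comment> \<open>all signs are allowed at every position\<close>
  define H where "H = replicate (2 * n + 1) (UNIV :: psign set)"
  have len: "length H = 2 * n + 1" by (simp add: H_def)
  have all: "restricted_perms H = signed_perms (2 * n + 1)"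
    by (auto simp: restricted_perms_iff H_def simp del: replicate_Suc)
  have "{u \<in> signed_perms (n + 1). double_word (int n + 1) u \<in> restricted_perms H} = signed_perms (n + 1)"
    using double_word_signed_perms by (auto simp: all)
  then show "(\<Sum>\<pi>\<in>signed_perms (2*n + 1). (-1) ^ inv_num (map abs \<pi>) * t ^ fdes \<pi>)
      = (1 - t\<^sup>2) ^ n * (\<Sum>\<pi>\<in>signed_perms (n + 1). t ^ fdes \<pi>)"
    using signed_sum_eq_double_word_sum[OF len, of t] by (simp only: all)
qed

end
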